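(* Let $X$ be a reproducing kernel Hilbert space on $S\subseteq\mathbb C^n$, and consider the dual Koopman system on $X$ $$\dot f(t)=A_F^*f(t),\quad f(0)=k_{\mathbf x_0},\qquad \mathbf y(t)=C_hf(t),$$ associated with the nonlinear system $\dot{\mathbf x}=F(\mathbf x)$, $\mathbf x(0)=\mathbf x_0$, $\mathbf y=h(\mathbf x)$. Then the dual Koopman system is pointwise approximately observable in infinite time if and only if the nonlinear system is observable in infinite time. Likewise, for $\tau>0$, the dual Koopman system is pointwise approximately observable in finite time $\tau$ if and only if the nonlinear system is observable in finite time $\tau$.
   Context: Setting. $X$ is a reproducing kernel Hilbert space (RKHS) of complex-valued functions on $S\subseteq\mathbb C^n$, with inner product $\langle\cdot,\cdot\rangle$ linear in the first argument; $k_{\mathbf x}\in X$ is the reproducing function at $\mathbf x\in S$: $\langle f,k_{\mathbf x}\rangle=f(\mathbf x)$ for all $f\in X$. The coordinate functions $p_k(\mathbf z)=z_k$, $k=1,\dots,n$, belong to $X$. The system $\dot{\mathbf x}=F(\mathbf x)$ generates a semiflow $\varphi^t:S\to S$, $t\ge 0$. The Koopman operators are $K(t)f=f\circ\varphi^t$; their generator is $A_Ff=F\cdot\nabla f$ with domain $D(A_F)=\{f\in X: F\cdot\nabla f\in X\}$; $A_F^*$ and $K(t)^*$ are the adjoints. One has $K(t)^*k_{\mathbf x}=k_{\varphi^t(\mathbf x)}$. The output map is $h=(h_1,\dots,h_m)\in X^m$, and $C_hg=(\langle g,h_1\rangle,\dots,\langle g,h_m\rangle)^T$ for $g\in X$.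 Standing assumptions: $K(t)$ and $K(t)^*$ are bounded on $X$ for all $t\geqslant 0$, and the dual Koopman system and the Koopman observer $\dot{\hat f}=A_F^*\hat f+L(C_h\hat f-\mathbf y)$, $\hat f(0)=\hat f_0$ ($L$ a bounded linear output injection operator) admit unique pseudo-weak solutions; that of the dual Koopman system is $f(t)=K(t)^*k_{\mathbf x_0}=k_{\varphi^t(\mathbf x_0)}$. Here a pseudo-weak solution of $\dot f=Af+\Gamma(t)$, $f(0)=f_0\in\mathrm{span}\{k_{\mathbf x}:\mathbf x\in S\}$ ($A$ closed and densely defined, $\Gamma(t)\in X$), is a function $f$ with (1) $f\in C([0,\tau],X)$ for all $\tau>0$; (2) $t\mapsto\langle f(t),g\rangle$ absolutely continuous for all $g\in D(A^* )$; (3) $\frac{d}{dt}\langle f(t),g\rangle=\langle f(t),A^*g\rangle+\langle\Gamma(t),g\rangle$ for all $g\in D(A^* )$. Definitions. The nonlinear system is observable in finite time $\tau>0$ (resp. in infinite time) if, for all $\mathbf z,\mathbf z'\in S$, $h(\varphi^t(\mathbf z))=h(\varphi^t(\mathbf z'))$ for all $t\in[0,\tau]$ (resp. for all $t\geqslant0$) implies $\mathbf z=\mathbf z'$. For $\tau>0$ let $\mathcal C^\tau:X\to L^2([0,\tau],\mathbb C^m)$, $f\mapsto C_hK(\cdot)^*f$, and $\mathcal K=\{k_{\mathbf z}-k_{\mathbf z'}:\mathbf z,\mathbf z'\in S\}$. The dual Koopman system is pointwise approximately observable in finite time $\tau>0$ if $\ker\mathcal C^\tau|_{\mathcal K}=\{0\}$,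 i.e. the only element of $\mathcal K$ annihilated by $\mathcal C^\tau$ is $0$; it is pointwise approximately observable in infinite time if $\bigcap_{\tau>0}\ker\mathcal C^\tau|_{\mathcal K}=\{0\}$. *)

theory Defs
  imports "HOL-Analysis.Analysis" "HOL-Library.Function_Algebras"
begin

type_synonym 'n cfun = "complex ^ 'n \<Rightarrow> complex"

definition cscale :: "complex \<Rightarrow> ('a \<Rightarrow> complex) \<Rightarrow> 'a \<Rightarrow> complex" where
  "cscale c f = (\<lambda>x. c * f x)"

interpretation cfun: vector_space "cscale :: complex \<Rightarrow> ('a \<Rightarrow> complex) \<Rightarrow> 'a \<Rightarrow> complex"
  by standard (auto simp: cscale_def fun_eq_iff algebra_simps)

definition abs_cont_on :: "real set \<Rightarrow> (real \<Rightarrow> complex) \<Rightarrow> bool" where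
  "abs_cont_on J u \<longleftrightarrow>
     (\<forall>\<epsilon>>0. \<exists>\<delta>>0. \<forall>N a b.
        (\<forall>i<(N::nat). a i \<le> b i \<and> {a i..b i} \<subseteq> J) \<and>
        (\<forall>i<N. \<forall>j<N. i \<noteq> j \<longrightarrow> {a i<..<b i} \<inter> {a j<..<b j} = {}) \<and>
        (\<Sum>i<N. b i - a i) < \<delta>
        \<longrightarrow> (\<Sum>i<N. norm (u (b i) - u (a i))) < \<epsilon>)"

text \<open>
  Complex-valued functions on \<open>S\<close> are represented by total functions that are \<open>0\<close> outside \<open>S\<close>,
  so that equality of functions on \<open>S\<close> is equality in HOL. The form \<open>ip\<close> is linear in its first
  argument. An operator is given by its domain \<open>D\<close> and a function \<open>T\<close>, used on \<open>D\<close> only.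
\<close>

locale rkhs =
  fixes S :: "(complex ^ 'n) set"
    and X :: "'n cfun set"
    and ip :: "'n cfun \<Rightarrow> 'n cfun \<Rightarrow> complex"
    and k :: "complex ^ 'n \<Rightarrow> 'n cfun"
  assumes S_nonempty: "S \<noteq> {}"
    and zero_outside: "\<And>f x. f \<in> X \<Longrightarrow> x \<notin> S \<Longrightarrow> f x = 0"
    and X_subspace: "cfun.subspace X"
    and ip_add_left: "\<And>f g u. f \<in> X \<Longrightarrow> g \<in> X \<Longrightarrow> u \<in> X \<Longrightarrow> ip (f + g) u = ip f u + ip g u"
    and ip_scale_left: "\<And>c f u. f \<in> X \<Longrightarrow> u \<in> X \<Longrightarrow> ip (cscale c f) u = c * ip f u"
    and ip_cnj: "\<And>f g. f \<in> X \<Longrightarrow> g \<in> X \<Longrightarrow> ip g f = cnj (ip f g)"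
    and ip_nonneg: "\<And>f. f \<in> X \<Longrightarrow> Re (ip f f) \<ge> 0"
    and ip_definite: "\<And>f. f \<in> X \<Longrightarrow> ip f f = 0 \<Longrightarrow> f = 0"
    and X_complete: "\<And>s. \<lbrakk>\<And>i::nat. s i \<in> X;
          \<And>e. e > 0 \<Longrightarrow> \<exists>N. \<forall>i\<ge>N. \<forall>j\<ge>N. sqrt (Re (ip (s i - s j) (s i - s j))) < e\<rbrakk>
        \<Longrightarrow> \<exists>f\<in>X. (\<lambda>i. sqrt (Re (ip (s i - f) (s i - f)))) \<longlonglongrightarrow> 0"
    and kernel_mem: "\<And>x. x \<in> S \<Longrightarrow> k x \<in> X"
    and reproducing: "\<And>f x. f \<in> X \<Longrightarrow> x \<in> S \<Longrightarrow> ip f (k x) = f x"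
begin

definition hnorm :: "'n cfun \<Rightarrow> real" where
  "hnorm f = sqrt (Re (ip f f))"

definition hcontinuous_on :: "real set \<Rightarrow> (real \<Rightarrow> 'n cfun) \<Rightarrow> bool" where
  "hcontinuous_on J f \<longleftrightarrow>
     (\<forall>t\<in>J. f t \<in> X \<and> ((\<lambda>s. hnorm (f s - f t)) \<longlongrightarrow> 0) (at t within J))"

definition bounded_op :: "('n cfun \<Rightarrow> 'n cfun) \<Rightarrow> bool" where
  "bounded_op T \<longleftrightarrow>
     (\<forall>f\<in>X. T f \<in> X) \<and>
     (\<forall>f\<in>X. \<forall>g\<in>X. T (f + g) = T f + T g) \<and>
     (\<forall>c. \<forall>f\<in>X. T (cscale c f) = cscale c (T f)) \<and>
     (\<exists>C. \<forall>f\<in>X. hnorm (T f) \<le> C * hnorm f)"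

definition dense_in_X :: "'n cfun set \<Rightarrow> bool" where
  "dense_in_X D \<longleftrightarrow> D \<subseteq> X \<and> (\<forall>f\<in>X. \<forall>e>0. \<exists>g\<in>D. hnorm (f - g) < e)"

definition closed_op :: "'n cfun set \<Rightarrow> ('n cfun \<Rightarrow> 'n cfun) \<Rightarrow> bool" where
  "closed_op D T \<longleftrightarrow>
     (\<forall>s f g. (\<forall>i::nat. s i \<in> D) \<and> f \<in> X \<and> g \<in> X \<and>
        (\<lambda>i. hnorm (s i - f)) \<longlonglongrightarrow> 0 \<and> (\<lambda>i. hnorm (T (s i) - g)) \<longlonglongrightarrow> 0
        \<longrightarrow> f \<in> D \<and> T f = g)"

definition adj_dom :: "'n cfun set \<Rightarrow> ('n cfun \<Rightarrow> 'n cfun) \<Rightarrow> 'n cfun set" where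
  "adj_dom D T = {g \<in> X. \<exists>g'\<in>X. \<forall>f\<in>D. ip (T f) g = ip f g'}"

definition adj :: "'n cfun set \<Rightarrow> ('n cfun \<Rightarrow> 'n cfun) \<Rightarrow> 'n cfun \<Rightarrow> 'n cfun" where
  "adj D T g = (THE g'. g' \<in> X \<and> (\<forall>f\<in>D. ip (T f) g = ip f g'))"

text \<open>
  Pseudo-weak solutions of \<open>f' = T f + \<Gamma>\<close>, \<open>f 0 = f0\<close>. Absolute continuity gives a derivative almost
  everywhere, so the differential equation is required for almost every \<open>t\<close>.
\<close>

definition pseudo_weak_solution ::
  "'n cfun set \<Rightarrow> ('n cfun \<Rightarrow> 'n cfun) \<Rightarrow> (real \<Rightarrow> 'n cfun) \<Rightarrow> 'n cfun \<Rightarrow> (real \<Rightarrow> 'n cfun) \<Rightarrow> bool"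
where
  "pseudo_weak_solution D T \<Gamma> f0 f \<longleftrightarrow>
     dense_in_X D \<and> closed_op D T \<and> (\<forall>t\<ge>0. \<Gamma> t \<in> X) \<and>
     f0 \<in> cfun.span (k ` S) \<and> f 0 = f0 \<and>
     (\<forall>\<tau>>0. hcontinuous_on {0..\<tau>} f) \<and>
     (\<forall>g\<in>adj_dom D T. \<forall>\<tau>>0. abs_cont_on {0..\<tau>} (\<lambda>t. ip (f t) g)) \<and>
     (\<forall>g\<in>adj_dom D T. AE t in lebesgue. t > 0 \<longrightarrow>
        ((\<lambda>t. ip (f t) g) has_vector_derivative ip (f t) (adj D T g) + ip (\<Gamma> t) g) (at t))"

end

locale koopman_system = rkhs S X ip k
  for S :: "(complex ^ 'n) set" and X ip k +
  fixes F :: "complex ^ 'n \<Rightarrow> complex ^ 'n"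
    and \<phi> :: "real \<Rightarrow> complex ^ 'n \<Rightarrow> complex ^ 'n"
    and h :: "('n cfun) ^ 'm"
  assumes coordinate_mem: "\<And>i. (\<lambda>x. if x \<in> S then x $ i else 0) \<in> X"
    and flow_in_S: "\<And>t x. t \<ge> 0 \<Longrightarrow> x \<in> S \<Longrightarrow> \<phi> t x \<in> S"
    and flow_zero: "\<And>x. x \<in> S \<Longrightarrow> \<phi> 0 x = x"
    and flow_add: "\<And>s t x. s \<ge> 0 \<Longrightarrow> t \<ge> 0 \<Longrightarrow> x \<in> S \<Longrightarrow> \<phi> (s + t) x = \<phi> s (\<phi> t x)"
    and flow_ode: "\<And>t x. t \<ge> 0 \<Longrightarrow> x \<in> S \<Longrightarrow>
          ((\<lambda>s. \<phi> s x) has_vector_derivative F (\<phi> t x)) (at t within {0..})"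
    and output_mem: "\<And>j. h $ j \<in> X"
begin

definition koopman :: "real \<Rightarrow> 'n cfun \<Rightarrow> 'n cfun" where
  "koopman t f = (\<lambda>x. if x \<in> S then f (\<phi> t x) else 0)"

definition koopman_adj :: "real \<Rightarrow> 'n cfun \<Rightarrow> 'n cfun" where
  "koopman_adj t = adj X (koopman t)"

definition has_gradient :: "'n cfun \<Rightarrow> complex ^ 'n \<Rightarrow> complex ^ 'n \<Rightarrow> bool" where
  "has_gradient f d x \<longleftrightarrow> (f has_derivative (\<lambda>v. \<Sum>i\<in>UNIV. v $ i * d $ i)) (at x within S)"

text \<open>
  If \<open>S\<close> has no interior at \<open>x\<close>, a gradient need not be unique. Its pairing with \<open>F x\<close> is unique
  nevertheless, being the right derivative of \<open>f (\<phi> t x)\<close> at \<open>t = 0\<close>.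
\<close>

definition generator :: "'n cfun \<Rightarrow> 'n cfun" where
  "generator f = (\<lambda>x. if x \<in> S then \<Sum>i\<in>UNIV. F x $ i * (SOME d. has_gradient f d x) $ i else 0)"

definition generator_dom :: "'n cfun set" where
  "generator_dom = {f \<in> X. (\<forall>x\<in>S. \<exists>d. has_gradient f d x) \<and> generator f \<in> X}"

definition generator_adj_dom :: "'n cfun set" where
  "generator_adj_dom = adj_dom generator_dom generator"

definition generator_adj :: "'n cfun \<Rightarrow> 'n cfun" where
  "generator_adj = adj generator_dom generator"

text \<open>Since \<open>ip\<close> is linear in its first argument, \<open>C_op (k x)\<close> is the componentwise conjugate of
  \<open>output_map x\<close>.\<close>

definition C_op :: "'n cfun \<Rightarrow> complex ^ 'm" where
  "C_op g = (\<chi> j. ip g (h $ j))"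

definition output_map :: "complex ^ 'n \<Rightarrow> complex ^ 'm" where
  "output_map x = (\<chi> j. (h $ j) x)"

definition observable_finite :: "real \<Rightarrow> bool" where
  "observable_finite \<tau> \<longleftrightarrow>
     (\<forall>z\<in>S. \<forall>z'\<in>S. (\<forall>t\<in>{0..\<tau>}. output_map (\<phi> t z) = output_map (\<phi> t z')) \<longrightarrow> z = z')"

definition observable_infinite :: bool where
  "observable_infinite \<longleftrightarrow>
     (\<forall>z\<in>S. \<forall>z'\<in>S. (\<forall>t\<ge>0. output_map (\<phi> t z) = output_map (\<phi> t z')) \<longrightarrow> z = z')"

definition kernel_differences :: "'n cfun set" where
  "kernel_differences = {k z - k z' | z z'. z \<in> S \<and> z' \<in> S}"

definition dual_output :: "'n cfun \<Rightarrow> real \<Rightarrow> complex ^ 'm" where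
  "dual_output f = (\<lambda>t. C_op (koopman_adj t f))"

definition L2_on :: "real \<Rightarrow> (real \<Rightarrow> complex ^ 'm) set" where
  "L2_on \<tau> = {y \<in> borel_measurable (lebesgue_on {0..\<tau>}).
                integrable (lebesgue_on {0..\<tau>}) (\<lambda>t. (norm (y t))\<^sup>2)}"

text \<open>
  The kernel of \<open>f \<mapsto> dual_output f\<close> as a map into \<open>L\<^sup>2([0,\<tau>])\<close>, whose zero element is the class of the
  functions that vanish almost everywhere.
\<close>

definition observability_kernel :: "real \<Rightarrow> 'n cfun set" where
  "observability_kernel \<tau> =
     {f \<in> X. dual_output f \<in> L2_on \<tau> \<and> (AE t in lebesgue_on {0..\<tau>}. dual_output f t = 0)}"

definition pointwise_approx_observable_finite :: "real \<Rightarrow> bool" where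
  "pointwise_approx_observable_finite \<tau> \<longleftrightarrow>
     observability_kernel \<tau> \<inter> kernel_differences = {0}"

definition pointwise_approx_observable_infinite :: bool where
  "pointwise_approx_observable_infinite \<longleftrightarrow>
     (\<Inter>\<tau>\<in>{0<..}. observability_kernel \<tau> \<inter> kernel_differences) = {0}"

definition dual_solution :: "complex ^ 'n \<Rightarrow> (real \<Rightarrow> 'n cfun) \<Rightarrow> bool" where
  "dual_solution x0 f \<longleftrightarrow>
     pseudo_weak_solution generator_adj_dom generator_adj (\<lambda>_. 0) (k x0) f"

definition observer_solution ::
  "(complex ^ 'm \<Rightarrow> 'n cfun) \<Rightarrow> (real \<Rightarrow> complex ^ 'm) \<Rightarrow> 'n cfun \<Rightarrow> (real \<Rightarrow> 'n cfun) \<Rightarrow> bool"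
where
  "observer_solution L y f0 f \<longleftrightarrow>
     pseudo_weak_solution generator_adj_dom generator_adj (\<lambda>t. L (C_op (f t) - y t)) f0 f"

end

locale koopman_observer_setting = koopman_system S X ip k F \<phi> h
  for S :: "(complex ^ 'n) set" and X ip k F \<phi> and h :: "('n cfun) ^ 'm" +
  fixes L :: "complex ^ 'm \<Rightarrow> 'n cfun"
  assumes koopman_bounded: "\<And>t. t \<ge> 0 \<Longrightarrow> bounded_op (koopman t)"
    and koopman_adj_bounded: "\<And>t. t \<ge> 0 \<Longrightarrow> bounded_op (koopman_adj t)"
    and generator_dense: "dense_in_X generator_dom"
    and L_mem: "\<And>v. L v \<in> X"
    and L_linear: "Vector_Spaces.linear (*s) cscale L"
    and L_bounded: "\<exists>B. \<forall>v. hnorm (L v) \<le> B * norm v"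
    and dual_solution_ex: "\<And>x0. x0 \<in> S \<Longrightarrow> dual_solution x0 (\<lambda>t. koopman_adj t (k x0))"
    and dual_solution_unique: "\<And>x0 f t. x0 \<in> S \<Longrightarrow> dual_solution x0 f \<Longrightarrow> t \<ge> 0 \<Longrightarrow>
          f t = koopman_adj t (k x0)"
    and observer_solution_ex: "\<And>x0 f0. x0 \<in> S \<Longrightarrow> f0 \<in> cfun.span (k ` S) \<Longrightarrow>
          \<exists>f. observer_solution L (dual_output (k x0)) f0 f"
    and observer_solution_unique: "\<And>x0 f0 f g t. x0 \<in> S \<Longrightarrow> f0 \<in> cfun.span (k ` S) \<Longrightarrow>
          observer_solution L (dual_output (k x0)) f0 f \<Longrightarrow>
          observer_solution L (dual_output (k x0)) f0 g \<Longrightarrow> t \<ge> 0 \<Longrightarrow> f t = g t"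

end

theory Submission
  imports Defs
begin

text \<open>
  Since \<open>K(t)\<^sup>* k\<^sub>z = k\<^bsub>\<phi>(t,z)\<^esub>\<close>, the output of the dual system started at
  \<open>k\<^sub>z - k\<^sub>z'\<close> is the complex conjugate of \<open>h(\<phi>(t,z)) - h(\<phi>(t,z'))\<close>. It is continuous in \<open>t\<close>
  because pseudo-weak solutions are norm continuous, so it vanishes in \<open>L\<^sup>2([0,\<tau>])\<close> only if it
  vanishes at every \<open>t\<close>. The coordinate functions in \<open>X\<close> make \<open>z \<mapsto> k\<^sub>z\<close> injective, so that
  \<open>k\<^sub>z - k\<^sub>z' = 0\<close> means \<open>z = z'\<close>.
\<close>

text \<open>The norm of \<open>y\<close> differs from 0 only on a null set, so its integral is 0; a
  nonnegative continuous function with integral 0 vanishes. The condition \<open>0 < \<tau>\<close>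
  excludes the one-point interval, which is itself a null set.\<close>

lemma continuous_on_AE_zero_imp_zero:
  fixes y :: "real \<Rightarrow> 'b::euclidean_space"
  assumes "0 < \<tau>" and cont: "continuous_on {0..\<tau>} y"
    and ae: "AE t in lebesgue_on {0..\<tau>}. y t = 0" and t: "t \<in> {0..\<tau>}"
  shows "y t = 0"
proof -
  have "AE t in lebesgue. t \<in> {0..\<tau>} \<longrightarrow> y t = 0"
    using ae by (simp add: AE_restrict_space_iff)
  then obtain N where N: "N \<in> null_sets lebesgue" "{t. \<not> (t \<in> {0..\<tau>} \<longrightarrow> y t = 0)} \<subseteq> N"
    by (auto simp: eventually_ae_filter)
  have "negligible N" using N(1) by (simp add: negligible_iff_null_sets)
  then have "((\<lambda>t. norm (y t)) has_integral 0) (cbox 0 \<tau>)"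
    by (rule has_integral_spike[where f = "\<lambda>_. 0"]) (use N(2) in auto)
  moreover have "continuous_on (cbox 0 \<tau>) (\<lambda>t. norm (y t))"
    using cont by (auto intro: continuous_intros)
  ultimately have "norm (y t) = 0"
    using has_integral_0_cbox_imp_0[of 0 \<tau> "\<lambda>t. norm (y t)" t] t \<open>0 < \<tau>\<close> by auto
  then show ?thesis by simp
qed

section \<open>Hilbert space geometry on the carrier set \<open>X\<close>\<close>

context rkhs
begin

lemma
  shows zero_mem: "0 \<in> X"
    and add_mem: "f \<in> X \<Longrightarrow> g \<in> X \<Longrightarrow> f + g \<in> X"
    and scale_mem: "f \<in> X \<Longrightarrow> cscale c f \<in> X"
    and diff_mem: "f \<in> X \<Longrightarrow> g \<in> X \<Longrightarrow> f - g \<in> X"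
  using X_subspace
  by (auto intro: cfun.subspace_0 cfun.subspace_add cfun.subspace_scale cfun.subspace_diff)

lemma ip_diff_left:
  assumes "f \<in> X" "g \<in> X" "u \<in> X"
  shows "ip (f - g) u = ip f u - ip g u"
  using ip_add_left[of "f - g" g u] assms diff_mem by simp

lemma ip_diff_right:
  assumes "f \<in> X" "g \<in> X" "u \<in> X"
  shows "ip u (f - g) = ip u f - ip u g"
  using assms ip_cnj[of "f - g" u] ip_cnj[of f u] ip_cnj[of g u] diff_mem
  by (simp add: ip_diff_left)

lemma ip_zero_left: "u \<in> X \<Longrightarrow> ip 0 u = 0"
  using ip_diff_left[of u u u] by simp

lemma ip_zero_right: "u \<in> X \<Longrightarrow> ip u 0 = 0"
  using ip_diff_right[of u u u] by simp

lemma ip_scale_right: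
  assumes "f \<in> X" "u \<in> X"
  shows "ip u (cscale c f) = cnj c * ip u f"
  using assms ip_cnj[of "cscale c f" u] ip_cnj[of f u] scale_mem
  by (simp add: ip_scale_left)

lemma ip_self_real: "f \<in> X \<Longrightarrow> ip f f = complex_of_real (Re (ip f f))"
  using ip_cnj[of f f] by (simp add: complex_eq_iff)

lemma Cauchy_Schwarz:
  assumes f: "f \<in> X" and g: "g \<in> X"
  shows "norm (ip f g) \<le> hnorm f * hnorm g"
proof (cases "ip g g = 0")
  case True
  then have "g = 0" using ip_definite g by blast
  then show ?thesis using ip_zero_right f g ip_nonneg by (simp add: hnorm_def)
next
  case False
  \<comment> \<open>The coefficient of the orthogonal projection of \<open>f\<close> onto the line
    through \<open>g\<close>; \<open>w\<close> is the orthogonal remainder, and the bound is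
    \<open>ip w w\<close> being nonnegative.\<close>
  define a where "a = ip f g / ip g g"
  define w where "w = f - cscale a g"
  define G where "G = Re (ip g g)"
  have w: "w \<in> X" unfolding w_def using f g diff_mem scale_mem by blast
  have gg: "ip g g = of_real G" using ip_self_real[OF g] by (simp add: G_def)
  have G: "G > 0"
  proof -
    have "G \<ge> 0" unfolding G_def using g by (rule ip_nonneg)
    moreover have "G \<noteq> 0" using False gg by auto
    ultimately show ?thesis by simp
  qed
  have "ip w g = 0"
    using False f g scale_mem by (simp add: w_def ip_diff_left ip_scale_left a_def)
  then have "ip w w = ip w f"
    using ip_diff_right[of f "cscale a g" w] w f g scale_mem ip_scale_right by (simp add: w_def)
  also have "\<dots> = ip f f - a * cnj (ip f g)"
    using f g scale_mem ip_cnj[of f g] by (simp add: w_def ip_diff_left ip_scale_left)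
  also have "a * cnj (ip f g) = of_real ((norm (ip f g))\<^sup>2 / G)"
    by (simp add: a_def gg complex_norm_square[symmetric] del: of_real_power flip: of_real_power)
  finally have "(norm (ip f g))\<^sup>2 / G \<le> Re (ip f f)"
    using ip_nonneg[OF w] by simp
  then have "(norm (ip f g))\<^sup>2 \<le> Re (ip f f) * G"
    using G by (simp add: divide_le_eq)
  then show ?thesis
    unfolding hnorm_def G_def by (metis real_le_rsqrt real_sqrt_mult)
qed

text \<open>Norm continuity implies weak continuity: Cauchy-Schwarz bounds the increment of the
  pairing by that of \<open>f\<close> times \<open>hnorm g\<close>.\<close>

lemma hcontinuous_on_imp_continuous_on_ip:
  assumes f: "hcontinuous_on J f" and g: "g \<in> X"
  shows "continuous_on J (\<lambda>t. ip (f t) g)"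
  unfolding continuous_on_def
proof
  fix t assume t: "t \<in> J"
  have mem: "\<And>s. s \<in> J \<Longrightarrow> f s \<in> X" using f by (auto simp: hcontinuous_on_def)
  have lim: "((\<lambda>s. hnorm (f s - f t) * hnorm g) \<longlongrightarrow> 0) (at t within J)"
    using f t by (auto simp: hcontinuous_on_def intro: tendsto_mult_left_zero)
  have "((\<lambda>s. ip (f s) g - ip (f t) g) \<longlongrightarrow> 0) (at t within J)"
  proof (rule Lim_null_comparison[OF _ lim])
    show "\<forall>\<^sub>F s in at t within J. norm (ip (f s) g - ip (f t) g) \<le> hnorm (f s - f t) * hnorm g"
      unfolding eventually_at_filter
    proof (rule always_eventually, intro allI impI)
      fix s assume "s \<in> J"
      then show "norm (ip (f s) g - ip (f t) g) \<le> hnorm (f s - f t) * hnorm g"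
        using Cauchy_Schwarz[OF diff_mem[OF mem mem[OF t]] g] ip_diff_left[OF mem mem[OF t] g]
        by metis
    qed
  qed
  then show "((\<lambda>s. ip (f s) g) \<longlongrightarrow> ip (f t) g) (at t within J)"
    by (rule LIM_zero_cancel)
qed

text \<open>Discharges the uniqueness behind the definite description in \<open>adj\<close>: as the
  domain is all of \<open>X\<close>, the difference of two candidates may serve as test vector, and
  it is then orthogonal to itself.\<close>

lemma adj_eqI:
  assumes "g' \<in> X" and "\<And>f. f \<in> X \<Longrightarrow> ip (T f) g = ip f g'"
  shows "adj X T g = g'"
  unfolding adj_def
proof (rule the_equality)
  fix u assume u: "u \<in> X \<and> (\<forall>f\<in>X. ip (T f) g = ip f u)"
  have d: "u - g' \<in> X" using u assms(1) diff_mem by simp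
  have "ip (u - g') u = ip (u - g') g'" using u d assms(2)[OF d] by simp
  then have "ip (u - g') (u - g') = 0"
    using u assms(1) d by (simp add: ip_diff_right)
  then have "u - g' = 0" using ip_definite[OF d] by blast
  then show "u = g'" by simp
qed (use assms in auto)

end

section \<open>Kernel functions under the adjoint Koopman operators and the output operator\<close>

context koopman_system
begin

lemma k_eq_iff:
  assumes "z \<in> S" "z' \<in> S"
  shows "k z = k z' \<longleftrightarrow> z = z'"
proof
  assume "k z = k z'"
  \<comment> \<open>Pairing the \<open>i\<close>-th coordinate function with \<open>k z\<close>
    evaluates it at \<open>z\<close>.\<close>
  then have "z $ i = z' $ i" for i
    using reproducing[OF coordinate_mem[of i]] assms by metis
  then show "z = z'" by (simp add: vec_eq_iff)
qed simp

text \<open>Both pairings equal \<open>f (\<phi> t z) - f (\<phi> t z')\<close> by the reproducing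
  property; boundedness supplies \<open>koopman t f \<in> X\<close>, where that property
  applies.\<close>

lemma koopman_adj_kernel_diff:
  assumes "bounded_op (koopman t)" "t \<ge> 0" "z \<in> S" "z' \<in> S"
  shows "koopman_adj t (k z - k z') = k (\<phi> t z) - k (\<phi> t z')"
  unfolding koopman_adj_def
proof (rule adj_eqI)
  show "k (\<phi> t z) - k (\<phi> t z') \<in> X"
    using assms flow_in_S kernel_mem diff_mem by simp
next
  fix f assume f: "f \<in> X"
  then have "koopman t f \<in> X" using assms(1) by (simp add: bounded_op_def)
  then show "ip (koopman t f) (k z - k z') = ip f (k (\<phi> t z) - k (\<phi> t z'))"
    using f assms flow_in_S kernel_mem by (simp add: ip_diff_right reproducing koopman_def)
qed

lemma koopman_adj_kernel:
  assumes "bounded_op (koopman t)" "t \<ge> 0" "z \<in> S"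
  shows "koopman_adj t (k z) = k (\<phi> t z)"
  unfolding koopman_adj_def
proof (rule adj_eqI)
  show "k (\<phi> t z) \<in> X" using assms flow_in_S kernel_mem by simp
next
  fix f assume f: "f \<in> X"
  then have "koopman t f \<in> X" using assms(1) by (simp add: bounded_op_def)
  then show "ip (koopman t f) (k z) = ip f (k (\<phi> t z))"
    using f assms flow_in_S by (simp add: reproducing koopman_def)
qed

text \<open>The kernels stand in the first slot of \<open>ip\<close>, whereas point evaluation has
  them in the second; swapping the slots produces the conjugate.\<close>

lemma C_op_kernel_diff:
  assumes "x \<in> S" "x' \<in> S"
  shows "C_op (k x - k x') = (\<chi> j. cnj (output_map x $ j - output_map x' $ j))"
proof -
  have "ip (k x - k x') (h $ j) = cnj ((h $ j) x - (h $ j) x')" for j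
    using assms kernel_mem output_mem[of j] ip_cnj[of "h $ j" "k x - k x'"] diff_mem
    by (simp add: ip_diff_right reproducing)
  then show ?thesis by (simp add: C_op_def output_map_def)
qed

end

section \<open>Observability of the dual system and of the flow\<close>

context koopman_observer_setting
begin

lemma dual_output_kernel_diff:
  assumes "t \<ge> 0" "z \<in> S" "z' \<in> S"
  shows "dual_output (k z - k z') t = C_op (k (\<phi> t z) - k (\<phi> t z'))"
  using assms koopman_bounded by (simp add: dual_output_def koopman_adj_kernel_diff)

lemma dual_output_kernel_diff_eq_0_iff:
  assumes "t \<ge> 0" "z \<in> S" "z' \<in> S"
  shows "dual_output (k z - k z') t = 0 \<longleftrightarrow> output_map (\<phi> t z) = output_map (\<phi> t z')"
  using assms flow_in_S
  by (simp add: dual_output_kernel_diff C_op_kernel_diff vec_eq_iff flip: complex_cnj_diff)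

text \<open>Each \<open>koopman_adj t (k x)\<close> is a pseudo-weak solution, hence norm continuous
  in \<open>t\<close>, and may be paired with any element of \<open>X\<close>, in particular with
  \<open>h $ j\<close>.\<close>

lemma continuous_on_dual_output_kernel_diff:
  assumes "0 < \<tau>" "z \<in> S" "z' \<in> S"
  shows "continuous_on {0..\<tau>} (dual_output (k z - k z'))"
proof -
  have cont: "continuous_on {0..\<tau>} (\<lambda>t. ip (koopman_adj t (k x)) (h $ j))" if "x \<in> S" for x j
    using dual_solution_ex[OF that] \<open>0 < \<tau>\<close> output_mem
    by (auto simp: dual_solution_def pseudo_weak_solution_def
        intro!: hcontinuous_on_imp_continuous_on_ip)
  have "continuous_on {0..\<tau>} (\<lambda>t. \<chi> j. ip (koopman_adj t (k z)) (h $ j)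
          - ip (koopman_adj t (k z')) (h $ j))"
    by (intro continuous_intros cont assms)
  \<comment> \<open>The output is split into two solutions by writing both sides through the kernels
    at \<open>\<phi> t z\<close> and \<open>\<phi> t z'\<close>.\<close>
  moreover have "dual_output (k z - k z') t = (\<chi> j. ip (koopman_adj t (k z)) (h $ j)
          - ip (koopman_adj t (k z')) (h $ j))" if "t \<in> {0..\<tau>}" for t
    using that assms flow_in_S kernel_mem output_mem koopman_bounded
    by (simp add: dual_output_kernel_diff C_op_def koopman_adj_kernel ip_diff_left)
  ultimately show ?thesis by (metis (no_types, lifting) continuous_on_eq)
qed

text \<open>Continuity on a compact interval gives square integrability and turns vanishing almost
  everywhere into vanishing everywhere.\<close>

lemma kernel_diff_mem_observability_kernel_iff:
  assumes "0 < \<tau>" "z \<in> S" "z' \<in> S"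
  shows "k z - k z' \<in> observability_kernel \<tau> \<longleftrightarrow>
    (\<forall>t\<in>{0..\<tau>}. output_map (\<phi> t z) = output_map (\<phi> t z'))"
proof -
  let ?y = "dual_output (k z - k z')"
  note cont = continuous_on_dual_output_kernel_diff[OF assms]
  have "?y \<in> L2_on \<tau>"
    unfolding L2_on_def
    using cont by (auto intro!: continuous_imp_measurable_on_sets_lebesgue
        continuous_imp_integrable_real continuous_intros)
  moreover have "k z - k z' \<in> X" using assms kernel_mem diff_mem by simp
  moreover have "(AE t in lebesgue_on {0..\<tau>}. ?y t = 0) \<longleftrightarrow> (\<forall>t\<in>{0..\<tau>}. ?y t = 0)"
  proof
    assume "AE t in lebesgue_on {0..\<tau>}. ?y t = 0"
    then show "\<forall>t\<in>{0..\<tau>}. ?y t = 0"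
      using continuous_on_AE_zero_imp_zero[OF assms(1) cont] by blast
  qed (rule AE_I2, simp)
  moreover have "(\<forall>t\<in>{0..\<tau>}. ?y t = 0) \<longleftrightarrow>
      (\<forall>t\<in>{0..\<tau>}. output_map (\<phi> t z) = output_map (\<phi> t z'))"
    using assms by (simp add: dual_output_kernel_diff_eq_0_iff)
  ultimately show ?thesis
    by (simp add: observability_kernel_def)
qed

lemma zero_mem_observability_kernel:
  assumes "0 < \<tau>"
  shows "0 \<in> observability_kernel \<tau>"
proof -
  obtain z where z: "z \<in> S" using S_nonempty by blast
  show ?thesis
    \<comment> \<open>Zero is the kernel difference of a point with itself.\<close>
    using kernel_diff_mem_observability_kernel_iff[OF assms z z] by simp
qed

text \<open>Stated for any \<open>K\<close> containing 0, so that it covers both a single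
  observability kernel and the intersection over all times. Injectivity of \<open>k\<close> on
  \<open>S\<close> converts a zero difference into equal points.\<close>

lemma Int_kernel_differences_eq_zero_iff:
  assumes "0 \<in> K"
  shows "K \<inter> kernel_differences = {0} \<longleftrightarrow>
    (\<forall>z\<in>S. \<forall>z'\<in>S. k z - k z' \<in> K \<longrightarrow> z = z')"
proof -
  obtain z where "z \<in> S" using S_nonempty by blast
  then have "k z - k z \<in> kernel_differences"
    unfolding kernel_differences_def by blast
  then have "0 \<in> K \<inter> kernel_differences" using assms by simp
  then have "K \<inter> kernel_differences = {0} \<longleftrightarrow> (\<forall>f\<in>kernel_differences. f \<in> K \<longrightarrow> f = 0)"
    by blast
  also have "\<dots> \<longleftrightarrow> (\<forall>z\<in>S. \<forall>z'\<in>S. k z - k z' \<in> K \<longrightarrow> k z - k z' = 0)"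
    unfolding kernel_differences_def by blast
  finally show ?thesis by (simp add: k_eq_iff)
qed

lemma pointwise_approx_observable_finite_iff:
  assumes "0 < \<tau>"
  shows "pointwise_approx_observable_finite \<tau> \<longleftrightarrow> observable_finite \<tau>"
  using assms
  by (simp add: pointwise_approx_observable_finite_def observable_finite_def
      Int_kernel_differences_eq_zero_iff zero_mem_observability_kernel
      kernel_diff_mem_observability_kernel_iff)

lemma pointwise_approx_observable_infinite_iff:
  "pointwise_approx_observable_infinite \<longleftrightarrow> observable_infinite"
proof -
  let ?K = "\<Inter>\<tau>\<in>{0<..}. observability_kernel \<tau>"
  have "(\<Inter>\<tau>\<in>{0<..}. observability_kernel \<tau> \<inter> kernel_differences) = ?K \<inter> kernel_differences"
    \<comment> \<open>A nonempty index set lets the factor \<open>kernel_differences\<close> leave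
      the intersection.\<close>
    using greaterThan_non_empty[of "0::real"] by blast
  moreover have "0 \<in> ?K" using zero_mem_observability_kernel by simp
  moreover have "k z - k z' \<in> ?K \<longleftrightarrow> (\<forall>t\<ge>0. output_map (\<phi> t z) = output_map (\<phi> t z'))"
    if "z \<in> S" "z' \<in> S" for z z'
  proof -
    have "(\<forall>\<tau>\<in>{0<..}. \<forall>t\<in>{0..\<tau>}. P t) \<longleftrightarrow> (\<forall>t\<ge>0. P t)" for P :: "real \<Rightarrow> bool"
    proof
      assume *: "\<forall>\<tau>\<in>{0<..}. \<forall>t\<in>{0..\<tau>}. P t"
      show "\<forall>t\<ge>0. P t"
      proof (intro allI impI)
        fix t :: real assume "0 \<le> t"
        \<comment> \<open>The horizon \<open>t + 1\<close> is positive even when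
          \<open>t = 0\<close>.\<close>
        then show "P t" using *[rule_format, of "t + 1" t] by simp
      qed
    qed simp
    then show ?thesis using that by (simp add: kernel_diff_mem_observability_kernel_iff)
  qed
  ultimately show ?thesis
    by (simp only: pointwise_approx_observable_infinite_def observable_infinite_def
        Int_kernel_differences_eq_zero_iff cong: ball_cong)
qed

end

theorem proposition5:
  fixes S :: "(complex ^ 'n) set"
    and X :: "'n cfun set"
    and ip :: "'n cfun \<Rightarrow> 'n cfun \<Rightarrow> complex"
    and k :: "complex ^ 'n \<Rightarrow> 'n cfun"
    and F :: "complex ^ 'n \<Rightarrow> complex ^ 'n"
    and \<phi> :: "real \<Rightarrow> complex ^ 'n \<Rightarrow> complex ^ 'n"
    and h :: "('n cfun) ^ 'm"
    and L :: "complex ^ 'm \<Rightarrow> 'n cfun"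
  assumes "koopman_observer_setting S X ip k F \<phi> h L"
  shows "(koopman_system.pointwise_approx_observable_infinite S X ip k \<phi> h
            \<longleftrightarrow> koopman_system.observable_infinite S \<phi> h)
       \<and> (\<forall>\<tau>>0. koopman_system.pointwise_approx_observable_finite S X ip k \<phi> h \<tau>
            \<longleftrightarrow> koopman_system.observable_finite S \<phi> h \<tau>)"
proof -
  interpret koopman_observer_setting S X ip k F \<phi> h L by fact
  show ?thesis
    using pointwise_approx_observable_infinite_iff pointwise_approx_observable_finite_iff by blast
qed

end
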